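(* Let $X$ be a real normed space with dual $X^*$, let $\varphi\colon X\to(-\infty,\infty]$ be finite at $\bar x\in X$, let $\varepsilon\ge 0$, and let $x^*\in X^*$. (i) We have $x^*\in\widehat\partial_\varepsilon\varphi(\bar x)$ if and only if for every $\xi>\varepsilon$ there is a neighborhood $V(\bar x)$ of $\bar x$ such that $$L_\xi(x/\bar x)\ge\langle x^*,x-\bar x\rangle\quad\text{for all }x\in V(\bar x),$$ where $L_\xi(x/\bar x):=\big(\varphi(x)-\varphi(\bar x)\big)+\xi\|x-\bar x\|$ (that is, the local linear optimistic evaluation of the not worthwhile to change loss function $L_\xi(\cdot/\bar x)$ holds around $\bar x$ with the rate of change $x^*$). (ii) If $\varepsilon=0$ and $x^*\in\widehat\partial\varphi(\bar x):=\widehat\partial_0\varphi(\bar x)$, then in addition there exist a neighborhood $V(\bar x)$ of $\bar x$ and a function $s\colon V(\bar x)\to\mathbb{R}$ that is Fréchet differentiable at $\bar x$ with $\nabla s(\bar x)=x^*$, $s(\bar x)=\varphi(\bar x)$, and $s(x)\le\varphi(x)$ for all $x\in V(\bar x)$.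
   Context: For $\vartheta\colon X\to(-\infty,\infty]$ finite at $\bar x$ and $\varepsilon\ge 0$, the (analytic) $\varepsilon$-subdifferential of $\vartheta$ at $\bar x$ is $$\widehat\partial_\varepsilon\vartheta(\bar x):=\Big\{x^*\in X^*\ \Big|\ \liminf_{x\to\bar x}\frac{\vartheta(x)-\vartheta(\bar x)-\langle x^*,x-\bar x\rangle}{\|x-\bar x\|}\ge-\varepsilon\Big\}$$ (the lower limit being over $x\ne\bar x$); its elements are called $\varepsilon$-subgradients. The proximal payoff with weight factor $\xi\ge 0$ is $Q_\xi(x/\bar x):=\varphi(x)+\xi\|x-\bar x\|$, so that $L_\xi(x/\bar x)=Q_\xi(x/\bar x)-Q_\xi(\bar x/\bar x)$. *)

theory Defs
  imports "HOL-Analysis.Analysis"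
begin

text \<open>
  Functions into \<open>(-\<infinity>, \<infinity>]\<close> are functions into \<^typ>\<open>ereal\<close> that avoid \<open>-\<infinity>\<close>, and the dual
  space is \<open>'a \<Rightarrow>\<^sub>L real\<close>. The definitions below are meaningful when \<open>\<phi> xbar\<close> is finite; this
  and \<open>\<phi> x \<noteq> -\<infinity>\<close> are assumed where they are used. The filter \<open>at xbar\<close> excludes the
  point \<open>xbar\<close> itself, so the quotient is never taken at a zero denominator. If the space is
  trivial, the filter is \<open>bot\<close> and the lower limit is \<open>\<infinity>\<close>.
\<close>

definition eps_subdifferential ::
  "real \<Rightarrow> ('a::real_normed_vector \<Rightarrow> ereal) \<Rightarrow> 'a \<Rightarrow> ('a \<Rightarrow>\<^sub>L real) set" where
  "eps_subdifferential \<epsilon> \<phi> xbar =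
     {x'. Liminf (at xbar)
            (\<lambda>x. (\<phi> x - \<phi> xbar - ereal (blinfun_apply x' (x - xbar))) / ereal (norm (x - xbar)))
          \<ge> - ereal \<epsilon>}"

abbreviation subdifferential ::
  "('a::real_normed_vector \<Rightarrow> ereal) \<Rightarrow> 'a \<Rightarrow> ('a \<Rightarrow>\<^sub>L real) set" where
  "subdifferential \<equiv> eps_subdifferential 0"

text \<open>
  The weight factor is \<open>\<xi>\<close>, the current position \<open>xbar\<close>; ``nwtc'' stands for ``not worthwhile to
  change''.
\<close>

definition proximal_payoff ::
  "('a::real_normed_vector \<Rightarrow> ereal) \<Rightarrow> real \<Rightarrow> 'a \<Rightarrow> 'a \<Rightarrow> ereal" where
  "proximal_payoff \<phi> \<xi> xbar x = \<phi> x + ereal (\<xi> * norm (x - xbar))"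

definition nwtc_loss ::
  "('a::real_normed_vector \<Rightarrow> ereal) \<Rightarrow> real \<Rightarrow> 'a \<Rightarrow> 'a \<Rightarrow> ereal" where
  "nwtc_loss \<phi> \<xi> xbar x = (\<phi> x - \<phi> xbar) + ereal (\<xi> * norm (x - xbar))"

lemma nwtc_loss_eq_payoff_diff:
  assumes "\<bar>\<phi> xbar\<bar> \<noteq> \<infinity>"
  shows "nwtc_loss \<phi> \<xi> xbar x = proximal_payoff \<phi> \<xi> xbar x - proximal_payoff \<phi> \<xi> xbar xbar"
  using assms
  by (cases "\<phi> x"; cases "\<phi> xbar") (auto simp: nwtc_loss_def proximal_payoff_def)

end

theory Submission
  imports Defs
begin

text \<open>
  Multiplying the difference quotient by the norm of \<open>x - xbar\<close> turns the lower bound \<open>-\<xi>\<close> on the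
  quotient into the inequality for the loss, which gives (i). For (ii) take the minimum of
  \<open>\<phi>\<close> and its affine model \<open>\<phi> xbar + x' (x - xbar)\<close>: it lies below \<open>\<phi>\<close>, is finite even where
  \<open>\<phi>\<close> is not, and differs from the model by at most \<open>\<xi> * norm (x - xbar)\<close> near \<open>xbar\<close>, for
  every \<open>\<xi> > 0\<close> by (i).
\<close>

lemma nwtc_loss_ge_iff_quotient_ge:
  fixes x' :: "'a::real_normed_vector \<Rightarrow>\<^sub>L real"
  assumes "\<phi> x \<noteq> -\<infinity>" and "\<bar>\<phi> xbar\<bar> \<noteq> \<infinity>" and "x \<noteq> xbar"
  shows "ereal (blinfun_apply x' (x - xbar)) \<le> nwtc_loss \<phi> \<xi> xbar x \<longleftrightarrow>
    ereal (- \<xi>) \<le> (\<phi> x - \<phi> xbar - ereal (blinfun_apply x' (x - xbar))) / ereal (norm (x - xbar))"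
proof -
  have n: "norm (x - xbar) > 0"
    using assms(3) by simp
  obtain a where a: "\<phi> xbar = ereal a"
    using assms(2) by auto
  show ?thesis
  proof (cases "\<phi> x")
    case (real r)
    have "- \<xi> \<le> (r - a - blinfun_apply x' (x - xbar)) / norm (x - xbar) \<longleftrightarrow>
        - \<xi> * norm (x - xbar) \<le> r - a - blinfun_apply x' (x - xbar)"
      using n by (rule pos_le_divide_eq)
    with n show ?thesis
      by (auto simp: nwtc_loss_def real a)
  next
    \<comment> \<open>Both inequalities hold here: the loss and the quotient, whose denominator is
      positive, are infinite.\<close>
    case PInf
    with n show ?thesis
      by (simp add: nwtc_loss_def a)
  next
    case MInf
    with assms(1) show ?thesis
      by simp
  qed
qed

text \<open>The lower limit is at least \<open>- \<epsilon>\<close> iff every level below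
  \<open>- \<epsilon>\<close> is eventually strictly exceeded by the quotient. Real levels
  \<open>- \<xi>\<close> suffice, and strict and weak bounds agree because the level can be shifted
  slightly.\<close>

lemma eps_subdifferential_iff_eventually:
  assumes "\<And>x. \<phi> x \<noteq> -\<infinity>" and "\<bar>\<phi> xbar\<bar> \<noteq> \<infinity>"
  shows "x' \<in> eps_subdifferential \<epsilon> \<phi> xbar \<longleftrightarrow>
    (\<forall>\<xi>>\<epsilon>. \<forall>\<^sub>F x in nhds xbar. ereal (blinfun_apply x' (x - xbar)) \<le> nwtc_loss \<phi> \<xi> xbar x)"
    (is "_ \<longleftrightarrow> (\<forall>\<xi>>\<epsilon>. ?N \<xi>)")
proof -
  define q where "q x = (\<phi> x - \<phi> xbar - ereal (blinfun_apply x' (x - xbar))) / ereal (norm (x - xbar))" for x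
  have N: "?N \<xi> \<longleftrightarrow> (\<forall>\<^sub>F x in at xbar. ereal (- \<xi>) \<le> q x)" for \<xi>
  proof -
    \<comment> \<open>At \<open>xbar\<close> both sides are 0, so the punctured filter, where the
      quotient makes sense, may replace the full neighborhood filter.\<close>
    have "ereal (blinfun_apply x' (xbar - xbar)) \<le> nwtc_loss \<phi> \<xi> xbar xbar"
      using assms(2) by (auto simp: nwtc_loss_def)
    then have "?N \<xi> \<longleftrightarrow>
        (\<forall>\<^sub>F x in at xbar. ereal (blinfun_apply x' (x - xbar)) \<le> nwtc_loss \<phi> \<xi> xbar x)"
      by (simp add: eventually_nhds_conv_at)
    also have "\<dots> \<longleftrightarrow> (\<forall>\<^sub>F x in at xbar. ereal (- \<xi>) \<le> q x)"
      using nwtc_loss_ge_iff_quotient_ge[of \<phi>, OF assms(1,2)]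
      by (intro eventually_cong[OF eventually_neq_at_within]) (auto simp: q_def)
    finally show ?thesis .
  qed
  have "x' \<in> eps_subdifferential \<epsilon> \<phi> xbar \<longleftrightarrow>
      (\<forall>y<ereal (- \<epsilon>). \<forall>\<^sub>F x in at xbar. y < q x)"
    by (simp add: eps_subdifferential_def le_Liminf_iff q_def)
  also have "\<dots> \<longleftrightarrow> (\<forall>\<xi>>\<epsilon>. ?N \<xi>)"
  proof (intro iffI allI impI)
    fix \<xi> assume "\<forall>y<ereal (- \<epsilon>). \<forall>\<^sub>F x in at xbar. y < q x" and "\<xi> > \<epsilon>"
    then have "\<forall>\<^sub>F x in at xbar. ereal (- \<xi>) < q x"
      by simp
    then show "?N \<xi>"
      unfolding N by (rule eventually_mono) simp
  next
    fix y assume bound: "\<forall>\<xi>>\<epsilon>. ?N \<xi>" and "y < ereal (- \<epsilon>)"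
    \<comment> \<open>A real level strictly between supplies the weight \<open>- r\<close>, even if
      \<open>y\<close> is minus infinity, and turns the weak bound at \<open>r\<close> into a strict
      one at \<open>y\<close>.\<close>
    then obtain r where r: "y < ereal r" "ereal r < ereal (- \<epsilon>)"
      using ereal_dense2 by blast
    then have "?N (- r)"
      using bound by simp
    then have "\<forall>\<^sub>F x in at xbar. ereal r \<le> q x"
      unfolding N by simp
    then show "\<forall>\<^sub>F x in at xbar. y < q x"
      by (rule eventually_mono) (use r(1) in order)
  qed
  finally show ?thesis .
qed

lemma subdifferential_smooth_minorant:
  fixes \<phi> :: "'a::real_normed_vector \<Rightarrow> ereal"
  assumes "\<And>x. \<phi> x \<noteq> -\<infinity>" and "\<bar>\<phi> xbar\<bar> \<noteq> \<infinity>" and "x' \<in> subdifferential \<phi> xbar"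
  obtains s :: "'a \<Rightarrow> real"
  where "(s has_derivative blinfun_apply x') (at xbar)"
    and "ereal (s xbar) = \<phi> xbar" and "\<And>x. ereal (s x) \<le> \<phi> x"
proof -
  obtain a where a: "\<phi> xbar = ereal a"
    using assms(2) by auto
  \<comment> \<open>\<open>real_of_ereal\<close> loses nothing: the affine model bounds the minimum
    above by a real, and \<phi> never takes the value minus infinity.\<close>
  define s where "s x = real_of_ereal (min (\<phi> x) (ereal (a + blinfun_apply x' (x - xbar))))" for x
  have s: "ereal (s x) = min (\<phi> x) (ereal (a + blinfun_apply x' (x - xbar)))" for x
    using assms(1)[of x] by (cases "\<phi> x") (auto simp: s_def min_def)
  have s_xbar: "s xbar = a"
    by (simp add: s_def a)
  \<comment> \<open>The error of \<open>s\<close> against the model is the minimum of 0 and \<phi>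
    minus the model; the loss inequality bounds the latter below by
    \<open>- \<xi> * norm (x - xbar)\<close>.\<close>
  have s_near: "\<bar>s x - s xbar - blinfun_apply x' (x - xbar)\<bar> \<le> \<xi> * norm (x - xbar)"
    if "ereal (blinfun_apply x' (x - xbar)) \<le> nwtc_loss \<phi> \<xi> xbar x" "\<xi> > 0" for x \<xi>
  proof -
    have "0 \<le> \<xi> * norm (x - xbar)"
      using that(2) by simp
    then show ?thesis
      using that(1) s[of x] assms(1)[of x] unfolding s_xbar
      by (cases "\<phi> x") (auto simp: nwtc_loss_def a min_def split: if_splits)
  qed
  have "(s has_derivative blinfun_apply x') (at xbar)"
    unfolding has_derivative_at_alt
  proof (intro conjI allI impI)
    show "bounded_linear (blinfun_apply x')"
      by (rule blinfun.bounded_linear_right)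
    \<comment> \<open>The tolerance \<open>e\<close> itself serves as the weight, since for
      \<epsilon> = 0 every positive weight is admissible.\<close>
    fix e :: real assume "e > 0"
    then have "\<forall>\<^sub>F x in nhds xbar. ereal (blinfun_apply x' (x - xbar)) \<le> nwtc_loss \<phi> e xbar x"
      using assms(3) eps_subdifferential_iff_eventually[of \<phi>, OF assms(1,2)] by blast
    then obtain d where "d > 0" and
      "\<And>x. dist x xbar < d \<Longrightarrow> ereal (blinfun_apply x' (x - xbar)) \<le> nwtc_loss \<phi> e xbar x"
      unfolding eventually_nhds_metric by blast
    then show "\<exists>d>0. \<forall>x. norm (x - xbar) < d \<longrightarrow>
        norm (s x - s xbar - blinfun_apply x' (x - xbar)) \<le> e * norm (x - xbar)"
      using s_near \<open>e > 0\<close> by (auto simp: dist_norm)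
  qed
  then show ?thesis
    by (rule that) (simp_all add: s_xbar a s)
qed

theorem theorem3p5:
  fixes \<phi> :: "'a::real_normed_vector \<Rightarrow> ereal"
    and xbar :: 'a
    and \<epsilon> :: real
    and x' :: "'a \<Rightarrow>\<^sub>L real"
  assumes "\<And>x. \<phi> x \<noteq> -\<infinity>"
    and "\<bar>\<phi> xbar\<bar> \<noteq> \<infinity>"
    and "\<epsilon> \<ge> 0"
  shows "(x' \<in> eps_subdifferential \<epsilon> \<phi> xbar \<longleftrightarrow>
            (\<forall>\<xi>>\<epsilon>. \<exists>V. open V \<and> xbar \<in> V \<and>
               (\<forall>x\<in>V. nwtc_loss \<phi> \<xi> xbar x \<ge> ereal (blinfun_apply x' (x - xbar))))) \<and>
         (\<epsilon> = 0 \<and> x' \<in> subdifferential \<phi> xbar \<longrightarrow>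
            (\<exists>V (s :: 'a \<Rightarrow> real). open V \<and> xbar \<in> V \<and>
               (s has_derivative blinfun_apply x') (at xbar) \<and>
               ereal (s xbar) = \<phi> xbar \<and>
               (\<forall>x\<in>V. ereal (s x) \<le> \<phi> x)))"
proof (intro conjI impI)
  show "x' \<in> eps_subdifferential \<epsilon> \<phi> xbar \<longleftrightarrow>
      (\<forall>\<xi>>\<epsilon>. \<exists>V. open V \<and> xbar \<in> V \<and>
         (\<forall>x\<in>V. nwtc_loss \<phi> \<xi> xbar x \<ge> ereal (blinfun_apply x' (x - xbar))))"
    unfolding eps_subdifferential_iff_eventually[of \<phi>, OF assms(1,2)] eventually_nhds ..
next
  assume "\<epsilon> = 0 \<and> x' \<in> subdifferential \<phi> xbar"
  then obtain s :: "'a \<Rightarrow> real"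
    where "(s has_derivative blinfun_apply x') (at xbar)"
      and "ereal (s xbar) = \<phi> xbar" and "\<And>x. ereal (s x) \<le> \<phi> x"
    using subdifferential_smooth_minorant[of \<phi>, OF assms(1,2)] by blast
  then show "\<exists>V (s :: 'a \<Rightarrow> real). open V \<and> xbar \<in> V \<and>
      (s has_derivative blinfun_apply x') (at xbar) \<and>
      ereal (s xbar) = \<phi> xbar \<and> (\<forall>x\<in>V. ereal (s x) \<le> \<phi> x)"
    \<comment> \<open>The minorant lies below \<phi> everywhere, so the whole space can be the
      neighborhood.\<close>
    by (intro exI[of _ UNIV] exI[of _ s]) simp
qed

end
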